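(* Let $G\colon M\to M$ be either the 2D-HC map ($M=[0,1]^2$, $G=F_{2\mathrm D}$) or the 3D-HC map ($M=[0,1]^3$, $G=F$). Then almost every pair $(p_1,p_2)\in M\times M$ (with respect to Lebesgue measure on $M\times M$) is a scrambled pair, that is, $$\liminf_{n\to\infty}\mathrm{dist}(G^n(p_1),G^n(p_2))=0\quad\text{and}\quad\limsup_{n\to\infty}\mathrm{dist}(G^n(p_1),G^n(p_2))=\mathrm{diam}(M),$$ where $\mathrm{dist}$ is the Euclidean distance and $\mathrm{diam}(M)$ is the diameter of $M$.
   Context: Define $\tau\colon[0,1]\to[0,1]$ by $\tau(x)=3x \bmod 1$ for $0\le x<1$ and $\tau(1)=1$. Let $A=[0,\frac13)\times[0,1]\times[0,1]$, $B=[\frac23,1]\times[0,1]\times[0,\frac12)$, $C=[\frac23,1]\times[0,1]\times[\frac12,1]$, $D=[\frac13,\frac23)\times[0,1]\times[0,1]$. The 3D-HC map $F\colon[0,1]^3\to[0,1]^3$ is $F(x,y,z)=(\tau(x),\frac23y,\frac12z)$ on $A$; $F(x,y,z)=(\tau(x),\frac23+\frac16y,2z)$ on $B$; $F(x,y,z)=(\tau(x),\frac56+\frac16y,-1+2z)$ on $C$; $F(x,y,z)=(\tau(x),\frac23y,\frac12+\frac12z)$ on $D$. The 2D-HC map $F_{2\mathrm D}\colon[0,1]^2\to[0,1]^2$ is $F_{2\mathrm D}(x,z)=\pi(F(x,0,z))$, where $\pi(x,y,z)=(x,z)$. *)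

theory Defs
  imports "HOL-Analysis.Analysis"
begin

text \<open>Points of the plane and of space are nested pairs of reals; the library metric on
  products is the Euclidean one, and \<open>lebesgue\<close> on these types is Lebesgue measure.\<close>

definition unit_square :: "(real \<times> real) set" where
  "unit_square = {0..1} \<times> {0..1}"

definition unit_cube :: "(real \<times> real \<times> real) set" where
  "unit_cube = {0..1} \<times> {0..1} \<times> {0..1}"

definition tau :: "real \<Rightarrow> real" where
  "tau x = (if x = 1 then 1 else frac (3 * x))"

definition HC_A :: "(real \<times> real \<times> real) set" where
  "HC_A = {0..<1/3} \<times> {0..1} \<times> {0..1}"

definition HC_B :: "(real \<times> real \<times> real) set" where
  "HC_B = {2/3..1} \<times> {0..1} \<times> {0..<1/2}"

definition HC_C :: "(real \<times> real \<times> real) set" where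
  "HC_C = {2/3..1} \<times> {0..1} \<times> {1/2..1}"

definition HC_D :: "(real \<times> real \<times> real) set" where
  "HC_D = {1/3..<2/3} \<times> {0..1} \<times> {0..1}"

text \<open>The four regions partition the unit cube; the map is left unspecified outside it.\<close>

definition HC_3D :: "real \<times> real \<times> real \<Rightarrow> real \<times> real \<times> real" where
  "HC_3D = (\<lambda>(x, y, z).
     if (x, y, z) \<in> HC_A then (tau x, 2/3 * y, 1/2 * z)
     else if (x, y, z) \<in> HC_B then (tau x, 2/3 + 1/6 * y, 2 * z)
     else if (x, y, z) \<in> HC_C then (tau x, 5/6 + 1/6 * y, -1 + 2 * z)
     else if (x, y, z) \<in> HC_D then (tau x, 2/3 * y, 1/2 + 1/2 * z)
     else undefined)"

definition proj_xz :: "real \<times> real \<times> real \<Rightarrow> real \<times> real" where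
  "proj_xz = (\<lambda>(x, y, z). (x, z))"

definition HC_2D :: "real \<times> real \<Rightarrow> real \<times> real" where
  "HC_2D = (\<lambda>(x, z). proj_xz (HC_3D (x, 0, z)))"

text \<open>The limits are taken in the extended reals, where \<open>liminf\<close> and \<open>limsup\<close> always exist.\<close>

definition scrambled_pair :: "'a::metric_space set \<Rightarrow> ('a \<Rightarrow> 'a) \<Rightarrow> 'a \<Rightarrow> 'a \<Rightarrow> bool" where
  "scrambled_pair M G p1 p2 \<longleftrightarrow>
     liminf (\<lambda>n. ereal (dist ((G ^^ n) p1) ((G ^^ n) p2))) = 0 \<and>
     limsup (\<lambda>n. ereal (dist ((G ^^ n) p1) ((G ^^ n) p2))) = ereal (diameter M)"

end

theory Submission
  imports Defs
begin

text \<open>The first coordinate evolves by \<open>tau\<close> alone, that is, by the shift on ternary digits, and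
  these digits decide what happens to the other coordinates. A suitable digit block therefore
  steers \<^emph>\<open>every\<close> point of the cube whose first coordinate begins with it close to a chosen corner.
  A long block of zeros leads to the corner of zeros (\<open>HC_3D_near_origin\<close>). For the corner of ones
  the coordinate \<open>z\<close> is regarded as a stack of bits: a block of ones pushes ones, a shorter block of
  twos pops some of them and thereby moves \<open>y\<close> to \<open>1\<close>, the ones that remain keep \<open>z\<close> near \<open>1\<close>, and
  further twos keep \<open>x\<close> near \<open>1\<close> (\<open>HC_3D_near_corner\<close>).

  For almost every pair of first coordinates, every pair of digit blocks of equal length occurs
  at a common place in the two expansions. This rests on a self-similarity argument: the
  set of pairs that never show a given pair of blocks is covered by fewer small copies of
  itself than would be needed to carry positive measure (\<open>negligible_avoiders\<close>). Outside the
  resulting null set \<open>exceptional\<close>, blocks of zeros for both points give times at which both are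
  near the same corner, so the lower limit of the distance is \<open>0\<close>; zeros for one point together
  with ones and twos for the other give times at which the points are near opposite corners,
  so the upper limit is the diameter. The planar statement follows since the projection that
  forgets \<open>y\<close> is continuous and intertwines the two maps.\<close>

section \<open>Pairs that avoid a digit pair\<close>

lemma borel_measurable_frac [measurable]: "(frac :: real \<Rightarrow> real) \<in> borel_measurable borel"
  unfolding frac_def by measurable

lemma frac_mult_frac: "frac (of_int k * frac x) = frac (of_int k * (x::real))"
proof -
  have "of_int k * frac x = of_int k * x - of_int (k * \<lfloor>x\<rfloor>)"
    by (simp add: frac_def algebra_simps)
  then show ?thesis
    by (simp only: frac_def floor_diff_of_int of_int_diff)
qed

text \<open>The base-\<open>q\<close> digit of \<open>x\<close> at place \<open>m\<close> is \<open>\<lfloor>q * frac (q ^ m * x)\<rfloor>\<close>, so what is avoided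
  is the digit pair \<open>(i, j)\<close> at a common place of both expansions. For \<open>q = 3 ^ L\<close> such a digit
  is a block of \<open>L\<close> ternary digits, which is how arbitrary blocks are covered.\<close>

definition avoiders :: "nat \<Rightarrow> int \<Rightarrow> int \<Rightarrow> (real \<times> real) set" where
  "avoiders q i j = {p \<in> {0..<1} \<times> {0..<1}.
     \<forall>m. \<not> (\<lfloor>real q * frac (real q ^ m * fst p)\<rfloor> = i \<and> \<lfloor>real q * frac (real q ^ m * snd p)\<rfloor> = j)}"

lemma avoidersD:
  assumes "(x, y) \<in> avoiders q i j"
  shows "\<lfloor>real q * frac (real q ^ m * x)\<rfloor> = i \<Longrightarrow> \<lfloor>real q * frac (real q ^ m * y)\<rfloor> \<noteq> j"
  using assms by (simp add: avoiders_def)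

lemma avoiders_borel: "avoiders q i j \<in> sets borel"
proof -
  have "{p \<in> space (borel \<Otimes>\<^sub>M borel). fst p \<in> {0..<1::real} \<and> snd p \<in> {0..<1::real} \<and>
     (\<forall>m. \<not> (\<lfloor>real q * frac (real q ^ m * fst p)\<rfloor> = i \<and> \<lfloor>real q * frac (real q ^ m * snd p)\<rfloor> = j))}
     \<in> sets (borel \<Otimes>\<^sub>M borel)"
    by measurable
  then show ?thesis
    unfolding borel_prod avoiders_def by (simp add: mem_Times_iff)
qed

text \<open>The set is self-similar. Cut the unit square into \<open>q\<^sup>2\<close> equal squares. The square
  belonging to the forbidden digits contains no point of the set, and the piece in each of the
  others, magnified by \<open>q\<close>, falls back into the set because deleting the leading digits keeps
  the avoidance. So the measure \<open>\<mu>\<close> of the set satisfies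
  \<open>q\<^sup>2 * \<mu> \<le> (q\<^sup>2 - 1) * \<mu>\<close>, which forces \<open>\<mu> = 0\<close>. This takes the place of
  a Borel--Cantelli or ergodicity argument.\<close>

lemma negligible_avoiders:
  assumes i: "0 \<le> i" "i < int q" and j: "0 \<le> j" "j < int q"
  shows "negligible (avoiders q i j)"
proof -
  define N where "N = avoiders q i j"
  define C where "C = (\<lambda>(a, b). N \<inter> {p. \<lfloor>real q * fst p\<rfloor> = a \<and> \<lfloor>real q * snd p\<rfloor> = b})"
  define I where "I = {0..<int q} \<times> {0..<int q} - {(i, j)}"
  have q: "real q > 0" using i by simp
  have N_borel: "N \<in> sets borel"
    unfolding N_def by (rule avoiders_borel)
  have N_bounded: "bounded N"
    by (rule bounded_subset[of "{0..1} \<times> {0..1}"])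
       (auto simp: N_def avoiders_def intro: bounded_Times)
  have N: "N \<in> lmeasurable"
    using N_borel N_bounded by (intro bounded_set_imp_lmeasurable) auto
  have C_borel: "C c \<in> sets borel" for c
  proof -
    have "{p \<in> space (borel \<Otimes>\<^sub>M borel). \<lfloor>real q * fst p\<rfloor> = fst c \<and> \<lfloor>real q * snd p\<rfloor> = snd c}
        \<in> sets (borel \<Otimes>\<^sub>M borel)"
      by measurable
    then show ?thesis
      using N_borel unfolding borel_prod C_def by (auto simp: case_prod_unfold)
  qed
  have scaled: "real q ^ 2 * measure lebesgue (C c) \<le> measure lebesgue N" for c
  proof -
    obtain a b where c: "c = (a, b)" by (cases c)
    \<comment> \<open>Magnification of the small square with digits \<open>(a, b)\<close> onto the unit square.\<close>
    define T where "T = (\<lambda>p. real q *\<^sub>R p + (- of_int a, - of_int b) :: real \<times> real)"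
    have "T ` C c \<subseteq> N"
    proof (rule image_subsetI, rule prod.exhaust)
      fix p x y assume "p \<in> C c" and p: "p = (x, y)"
      then have xy: "(x, y) \<in> N" and fl: "\<lfloor>real q * x\<rfloor> = a" "\<lfloor>real q * y\<rfloor> = b"
        by (auto simp: C_def c)
      have T: "T (x, y) = (frac (real q * x), frac (real q * y))"
        using fl by (simp add: T_def frac_def)
      have shift: "frac (real q ^ m * frac (real q * t)) = frac (real q ^ Suc m * t)" for m t
        using frac_mult_frac[of "int q ^ m" "real q * t"] by (simp add: algebra_simps)
      have "\<not> (\<lfloor>real q * frac (real q ^ Suc m * x)\<rfloor> = i \<and> \<lfloor>real q * frac (real q ^ Suc m * y)\<rfloor> = j)" for m
        using avoidersD[OF xy[unfolded N_def]] by blast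
      then show "T p \<in> N"
        unfolding p T N_def avoiders_def by (simp add: shift frac_lt_1 del: power_Suc)
    qed
    moreover have T_C: "T ` C c \<in> sets borel"
    proof -
      define U where "U = (\<lambda>p :: real \<times> real. (1 / real q) *\<^sub>R (p + (of_int a, of_int b)))"
      have "U (T p) = p" "T (U p) = p" for p
        using q by (cases p; simp add: T_def U_def)+
      then have "T ` C c = U -` C c"
        by (auto simp: image_iff) metis
      moreover have "U \<in> borel_measurable borel"
        unfolding U_def by measurable
      ultimately show ?thesis
        using measurable_sets_borel[OF _ C_borel] by simp
    qed
    ultimately have "measure lebesgue (T ` C c) \<le> measure lebesgue N"
      using N T_C by (intro measure_mono_fmeasurable) auto
    moreover have "measure lebesgue (T ` C c) = real q ^ 2 * measure lebesgue (C c)"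
      unfolding T_def by (subst measure_lebesgue_affine) (simp add: power2_eq_square)
    ultimately show ?thesis by simp
  qed
  have cover: "N \<subseteq> (\<Union>c\<in>I. C c)"
  proof safe
    fix x y assume xy: "(x, y) \<in> N"
    then have 01: "0 \<le> x" "x < 1" "0 \<le> y" "y < 1"
      by (auto simp: N_def avoiders_def)
    \<comment> \<open>The leading digits are those at place \<open>m = 0\<close>.\<close>
    have "\<not> (\<lfloor>real q * frac (real q ^ 0 * x)\<rfloor> = i \<and> \<lfloor>real q * frac (real q ^ 0 * y)\<rfloor> = j)"
      using avoidersD[OF xy[unfolded N_def]] by blast
    then have ne: "\<not> (\<lfloor>real q * x\<rfloor> = i \<and> \<lfloor>real q * y\<rfloor> = j)"
      using 01 by (simp add: frac_eq)
    moreover have "\<lfloor>real q * x\<rfloor> \<in> {0..<int q}" "\<lfloor>real q * y\<rfloor> \<in> {0..<int q}"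
      using 01 q by (auto simp: floor_less_iff)
    ultimately show "(x, y) \<in> (\<Union>c\<in>I. C c)"
      using xy by (auto simp: I_def C_def)
  qed
  have finI: "finite I" and cardI: "real (card I) = real q ^ 2 - 1"
  proof -
    show "finite I" by (simp add: I_def)
    have "card I = q * q - 1"
      using i j by (simp add: I_def card_Diff_singleton)
    then show "real (card I) = real q ^ 2 - 1"
      using q by (simp add: power2_eq_square of_nat_diff)
  qed
  have "measure lebesgue N \<le> measure lebesgue (\<Union>c\<in>I. C c)"
    using cover N C_borel finI
    by (intro measure_mono_fmeasurable fmeasurable.finite_UN)
       (auto intro!: bounded_set_imp_lmeasurable bounded_subset[OF N_bounded] simp: C_def)
  also have "\<dots> \<le> (\<Sum>c\<in>I. measure lebesgue (C c))"
    using finI C_borel by (intro measure_UNION_le) auto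
  finally have "real q ^ 2 * measure lebesgue N \<le> (\<Sum>c\<in>I. real q ^ 2 * measure lebesgue (C c))"
    by (simp add: sum_distrib_left[symmetric] mult_left_mono)
  also have "\<dots> \<le> (\<Sum>c\<in>I. measure lebesgue N)"
    by (intro sum_mono scaled)
  also have "\<dots> = (real q ^ 2 - 1) * measure lebesgue N"
    using cardI by simp
  finally have "measure lebesgue N \<le> 0"
    by (simp add: algebra_simps)
  then have "measure lebesgue N = 0"
    using measure_nonneg[of lebesgue N] by linarith
  then show ?thesis
    using N by (simp add: N_def negligible_iff_measure)
qed

section \<open>Lifting almost-everywhere statements from the first coordinates\<close>

lemma AE_fst_lborel:
  assumes "AE x in lborel. Q (x::real)"
  shows "AE p in lborel. Q (fst (p :: real \<times> 'b::euclidean_space))"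
proof -
  obtain N where N: "N \<in> null_sets lborel" "{x. \<not> Q x} \<subseteq> N"
    using assms by (auto simp: eventually_ae_filter)
  have "AE p in lborel \<Otimes>\<^sub>M (lborel :: 'b measure). fst p \<notin> N"
  proof (rule lborel_pair.AE_pair_measure)
    show "{p \<in> space (lborel \<Otimes>\<^sub>M lborel). fst (p :: real \<times> 'b) \<notin> N} \<in> sets (lborel \<Otimes>\<^sub>M lborel)"
    proof -
      have [measurable]: "N \<in> sets borel" using N(1) by auto
      show ?thesis by measurable
    qed
    show "AE x in lborel. AE y in (lborel :: 'b measure). fst (x, y) \<notin> N"
      using AE_not_in[OF N(1)] by (rule eventually_mono) simp
  qed
  then show ?thesis
    unfolding lborel_prod using N(2) by (auto elim: eventually_mono)
qed

text \<open>A condition on the first coordinates of two points lifts from the plane to pairs of points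
  by Fubini, applied once to split the plane and once to recombine the two points.\<close>

lemma AE_fst_fst_lborel:
  assumes "AE c in lborel. c \<notin> N" and N [measurable]: "N \<in> sets (borel :: (real \<times> real) measure)"
  shows "AE (p1, p2) in lborel.
     (fst (p1 :: real \<times> 'b::euclidean_space), fst (p2 :: real \<times> 'b)) \<notin> N"
proof -
  have [measurable]: "N \<in> sets (borel \<Otimes>\<^sub>M borel)"
    using N unfolding borel_prod .
  have "AE x1 in lborel. AE x2 in lborel. (x1, x2) \<notin> N"
    using assms(1) unfolding lborel_prod[symmetric] by (rule lborel_pair.AE_pair)
  then have "AE x1 in lborel. AE p2 in lborel. (x1, fst (p2 :: real \<times> 'b)) \<notin> N"
    by (rule eventually_mono) (rule AE_fst_lborel)
  then have *: "AE p1 in lborel. AE p2 in lborel.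
      (fst (p1 :: real \<times> 'b), fst (p2 :: real \<times> 'b)) \<notin> N"
    by (rule AE_fst_lborel)
  have [measurable]: "fst \<in> (lborel :: (real \<times> 'b) measure) \<rightarrow>\<^sub>M borel"
    unfolding lborel_prod[symmetric] by measurable
  have "AE c in (lborel :: (real \<times> 'b) measure) \<Otimes>\<^sub>M (lborel :: (real \<times> 'b) measure).
      (fst (fst c), fst (snd c)) \<notin> N"
  proof (rule lborel_pair.AE_pair_measure)
    show "{c \<in> space (lborel \<Otimes>\<^sub>M lborel). (fst (fst (c :: (real \<times> 'b) \<times> real \<times> 'b)), fst (snd c)) \<notin> N}
        \<in> sets (lborel \<Otimes>\<^sub>M lborel)"
      by measurable
  qed (use * in simp)
  then show ?thesis
    unfolding lborel_prod by (simp add: case_prod_unfold)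
qed

lemma AE_lebesgue_onI:
  assumes N: "N \<in> null_sets lborel" and S: "S \<in> sets borel"
    and P: "\<And>p1 p2. p1 \<in> S \<Longrightarrow> p2 \<in> S \<Longrightarrow> (fst p1, fst p2) \<notin> N \<Longrightarrow> P p1 p2"
  shows "AE (p1, p2) in lebesgue_on (S \<times> S). P (p1 :: real \<times> 'b::euclidean_space) p2"
proof -
  have "AE c in lborel. case c of (p1 :: real \<times> 'b, p2 :: real \<times> 'b) \<Rightarrow> (fst p1, fst p2) \<notin> N"
    using N by (intro AE_fst_fst_lborel AE_not_in) auto
  then have "AE c in lebesgue. c \<in> S \<times> S \<longrightarrow> (case c of (p1, p2) \<Rightarrow> P p1 p2)"
    by (intro AE_completion) (auto intro: P elim!: eventually_mono)
  moreover have "S \<times> S \<in> sets borel"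
    using pair_measureI[OF S S] unfolding borel_prod .
  ultimately show ?thesis
    by (subst AE_restrict_space_iff) auto
qed

section \<open>Dense orbits of the base-three expansion of a pair\<close>

text \<open>One null set serves both systems, because only the first coordinates matter. The two
  lines on which a coordinate is \<open>1\<close> are included because \<open>tau 1\<close> differs from \<open>frac (3 * 1)\<close>.\<close>

definition exceptional :: "(real \<times> real) set" where
  "exceptional = {1} \<times> UNIV \<union> UNIV \<times> {1} \<union>
     (\<Union>L. \<Union>i\<in>{0..<3 ^ L}. \<Union>j\<in>{0..<3 ^ L}. avoiders (3 ^ L) i j)"

lemma exceptional_null: "exceptional \<in> null_sets lborel"
proof -
  have "avoiders (3 ^ L) i j \<in> null_sets lborel" if "i \<in> {0..<3 ^ L}" "j \<in> {0..<3 ^ L}" for L i j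
    using negligible_avoiders[of i "3 ^ L" j] avoiders_borel[of "3 ^ L" i j] that
    by (simp add: negligible_iff_null_sets null_sets_completion_iff)
  then have "(\<Union>L. \<Union>i\<in>{0..<3 ^ L}. \<Union>j\<in>{0..<3 ^ L}. avoiders (3 ^ L) i j) \<in> null_sets lborel"
    by (intro null_sets_UN' countableI_type) auto
  moreover have "{1::real} \<in> null_sets lborel"
    by (auto simp: null_sets_def)
  then have "{1} \<times> (UNIV :: real set) \<in> null_sets (lborel :: (real \<times> real) measure)"
    "(UNIV :: real set) \<times> {1} \<in> null_sets (lborel :: (real \<times> real) measure)"
    using lborel.times_in_null_sets1[of "{1::real}" lborel "UNIV :: real set"]
      lborel.times_in_null_sets2[of "UNIV :: real set" lborel "{1::real}"]
    unfolding lborel_prod by auto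
  ultimately show ?thesis
    unfolding exceptional_def by (intro null_sets.Un)
qed

text \<open>An interval longer than two triadic steps contains a whole triadic interval; the one to
  the right of the triadic interval of \<open>a\<close> will do.\<close>

lemma triadic_interval:
  fixes a b :: real
  assumes ab: "0 \<le> a" "b \<le> 1" "2 / 3 ^ L < b - a"
  obtains i :: int where "0 \<le> i" "i < 3 ^ L" "\<And>t :: real. \<lfloor>3 ^ L * t\<rfloor> = i \<Longrightarrow> a < t \<and> t < b"
proof
  define i where "i = \<lfloor>3 ^ L * a\<rfloor> + 1"
  have q: "(3::real) ^ L > 0" by simp
  have i: "3 ^ L * a < of_int i" "of_int i \<le> 3 ^ L * a + 1"
    unfolding i_def by linarith+
  have "3 ^ L * (b - a) > 2"
    using ab(3) by (simp add: field_simps)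
  then have ib: "of_int i + 1 < 3 ^ L * b"
    using i by (simp add: algebra_simps)
  show "0 \<le> i" using ab(1) by (simp add: i_def)
  have "3 ^ L * b \<le> 3 ^ L"
    using ab(2) by simp
  then have "real_of_int i < 3 ^ L"
    using ib by linarith
  then have "real_of_int i < real_of_int (3 ^ L)"
    by simp
  then show "i < 3 ^ L"
    by (simp only: of_int_less_iff)
  fix t :: real assume "\<lfloor>3 ^ L * t\<rfloor> = i"
  then have "of_int i \<le> 3 ^ L * t" "3 ^ L * t < of_int i + 1"
    by linarith+
  then have "3 ^ L * a < 3 ^ L * t" "3 ^ L * t < 3 ^ L * b"
    using i ib by linarith+
  then show "a < t \<and> t < b"
    using q by simp
qed

lemma tau_funpow: "x \<in> {0..<1} \<Longrightarrow> (tau ^^ n) x = frac (3 ^ n * x)"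
proof (induction n)
  case 0
  then show ?case by (simp add: frac_eq)
next
  case (Suc n)
  have "frac (3 ^ n * x) \<noteq> 1"
    using frac_lt_1[of "3 ^ n * x"] by linarith
  then show ?case
    using Suc frac_mult_frac[of 3 "3 ^ n * x"] by (simp add: tau_def algebra_simps)
qed

text \<open>Outside the exceptional set the orbit of \<open>(x, y)\<close> under \<open>tau \<times> tau\<close> is dense in the square:
  every box contains a triadic square, and visiting it means reading a prescribed pair of
  digit blocks.\<close>

lemma orbit_dense_outside_exceptional:
  assumes x: "x \<in> {0..1}" and y: "y \<in> {0..1}" and ne: "(x, y) \<notin> exceptional"
    and ab: "0 \<le> a" "a < b" "b \<le> 1" and cd: "0 \<le> c" "c < d" "d \<le> 1"
  obtains n where "(tau ^^ n) x \<in> {a<..<b}" "(tau ^^ n) y \<in> {c<..<d}"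
proof -
  have xy: "x \<in> {0..<1}" "y \<in> {0..<1}"
    using x y ne by (auto simp: exceptional_def)
  define e where "e = min (b - a) (d - c) / 2"
  have "e > 0" using ab cd by (simp add: e_def)
  then obtain L where "(1/3) ^ L < e"
    using real_arch_pow_inv[of e "1/3"] by auto
  then have L: "2 / 3 ^ L < b - a" "2 / 3 ^ L < d - c"
    by (simp_all add: e_def power_one_over)
  obtain i where i: "0 \<le> i" "i < 3 ^ L" "\<And>t. \<lfloor>3 ^ L * t\<rfloor> = i \<Longrightarrow> a < t \<and> t < b"
    using triadic_interval[OF ab(1,3) L(1)] by blast
  obtain j where j: "0 \<le> j" "j < 3 ^ L" "\<And>t. \<lfloor>3 ^ L * t\<rfloor> = j \<Longrightarrow> c < t \<and> t < d"
    using triadic_interval[OF cd(1,3) L(2)] by blast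
  have "(x, y) \<notin> avoiders (3 ^ L) i j"
    using ne i j by (auto simp: exceptional_def)
  then obtain m where "\<lfloor>3 ^ L * frac ((3 ^ L) ^ m * x)\<rfloor> = i" "\<lfloor>3 ^ L * frac ((3 ^ L) ^ m * y)\<rfloor> = j"
    using xy by (auto simp: avoiders_def)
  then show thesis
    using i(3) j(3) xy by (intro that[of "L * m"]) (simp_all add: tau_funpow power_mult)
qed

section \<open>Scrambled pairs from subsequences\<close>

lemma liminf_le_subsequence:
  fixes d :: "nat \<Rightarrow> ereal"
  assumes r: "filterlim r at_top sequentially" and lim: "(\<lambda>k. d (r k)) \<longlonglongrightarrow> l"
  shows "liminf d \<le> l"
proof -
  have "liminf d \<le> liminf (\<lambda>k. d (r k))"
    unfolding le_Liminf_iff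
    using eventually_compose_filterlim[OF less_LiminfD r] by blast
  then show ?thesis
    using lim_imp_Liminf[OF _ lim] by simp
qed

lemma limsup_ge_subsequence:
  fixes d :: "nat \<Rightarrow> ereal"
  assumes r: "filterlim r at_top sequentially" and lim: "(\<lambda>k. d (r k)) \<longlonglongrightarrow> l"
  shows "l \<le> limsup d"
proof -
  have "limsup (\<lambda>k. d (r k)) \<le> limsup d"
    unfolding Limsup_le_iff
    using eventually_compose_filterlim[OF Limsup_lessD r] by blast
  then show ?thesis
    using lim_imp_Limsup[OF _ lim] by simp
qed

text \<open>Subsequences decide both limits: along \<open>r\<close> the distance tends to zero, and along \<open>s\<close> it tends
  to the distance of two points that realise the diameter and so bound every other distance.\<close>

lemma scrambled_pairI:
  fixes G :: "'a::real_normed_vector \<Rightarrow> 'a"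
  assumes orbit: "\<And>n. (G ^^ n) p \<in> M" "\<And>n. (G ^^ n) q \<in> M"
    and ab: "a \<in> M" "b \<in> M" "\<And>u v. u \<in> M \<Longrightarrow> v \<in> M \<Longrightarrow> dist u v \<le> dist a b"
    and r: "filterlim r at_top sequentially"
      "(\<lambda>k. (G ^^ r k) p) \<longlonglongrightarrow> c" "(\<lambda>k. (G ^^ r k) q) \<longlonglongrightarrow> c"
    and s: "filterlim s at_top sequentially"
      "(\<lambda>k. (G ^^ s k) p) \<longlonglongrightarrow> a" "(\<lambda>k. (G ^^ s k) q) \<longlonglongrightarrow> b"
  shows "scrambled_pair M G p q"
proof -
  define d where "d = (\<lambda>n. ereal (dist ((G ^^ n) p) ((G ^^ n) q)))"
  have "bounded M"
    unfolding bounded_def using ab by blast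
  then have diam: "diameter M = dist a b"
    using ab by (intro antisym diameter_le diameter_bounded_bound) (auto simp: dist_norm)
  have "(\<lambda>k. d (r k)) \<longlonglongrightarrow> ereal (dist c c)"
    unfolding d_def by (intro tendsto_intros r lim_ereal[THEN iffD2])
  then have "liminf d \<le> 0"
    using liminf_le_subsequence[OF r(1)] by (simp add: zero_ereal_def)
  moreover have "0 \<le> liminf d"
    by (intro Liminf_bounded always_eventually) (simp add: d_def)
  moreover have "(\<lambda>k. d (s k)) \<longlonglongrightarrow> ereal (dist a b)"
    unfolding d_def by (intro tendsto_intros s lim_ereal[THEN iffD2])
  then have "ereal (dist a b) \<le> limsup d"
    by (rule limsup_ge_subsequence[OF s(1)])
  moreover have "limsup d \<le> ereal (dist a b)"
    by (intro Limsup_bounded always_eventually) (auto simp: d_def intro: ab orbit)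
  ultimately show ?thesis
    by (auto simp: scrambled_pair_def diam d_def)
qed

section \<open>The map on the cube and its planar factor\<close>

lemma HC_3D_cube: "p \<in> unit_cube \<Longrightarrow> HC_3D p \<in> unit_cube"
  by (cases p)
     (auto simp: unit_cube_def HC_3D_def HC_A_def HC_B_def HC_C_def HC_D_def tau_def
       intro: less_imp_le[OF frac_lt_1])

lemma HC_3D_funpow_cube: "p \<in> unit_cube \<Longrightarrow> (HC_3D ^^ n) p \<in> unit_cube"
  by (induction n) (auto intro: HC_3D_cube)

lemma fst_HC_3D: "p \<in> unit_cube \<Longrightarrow> fst (HC_3D p) = tau (fst p)"
  by (cases p)
     (auto simp: unit_cube_def HC_3D_def HC_A_def HC_B_def HC_C_def HC_D_def)

lemma fst_HC_3D_funpow: "p \<in> unit_cube \<Longrightarrow> fst ((HC_3D ^^ n) p) = (tau ^^ n) (fst p)"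
  by (induction n) (auto simp: fst_HC_3D HC_3D_funpow_cube)

text \<open>The planar map is a factor of the spatial one: the middle coordinate influences neither
  the region nor the other two coordinates.\<close>

lemma HC_2D_proj: "p \<in> unit_cube \<Longrightarrow> HC_2D (proj_xz p) = proj_xz (HC_3D p)"
  by (cases p)
     (auto simp: HC_2D_def proj_xz_def unit_cube_def HC_3D_def HC_A_def HC_B_def HC_C_def HC_D_def)

lemma HC_2D_funpow_proj:
  "p \<in> unit_cube \<Longrightarrow> (HC_2D ^^ n) (proj_xz p) = proj_xz ((HC_3D ^^ n) p)"
  by (induction n) (auto simp: HC_2D_proj HC_3D_funpow_cube)

section \<open>Runs of equal digits\<close>

lemma tau_branch: "u \<in> {0..<1} \<Longrightarrow> j \<in> {0, 1, 2} \<Longrightarrow> tau ((of_int j + u) / 3) = u"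
  by (auto simp: tau_def frac_unique_iff field_simps)

text \<open>The map in terms of the leading ternary digit of the first coordinate. The binary
  expansion of \<open>z\<close> acts as a stack: the digits \<open>0\<close> and \<open>1\<close> push themselves, and \<open>2\<close> pops the top
  bit. In the last equation the top bit is \<open>1\<close>, so that the popped bit moves \<open>y\<close> towards \<open>1\<close>.
  Each branch is affine, and the coordinates are written relative to its fixed point, so that
  iterates of one branch need only powers of the slopes.\<close>

lemma HC_3D_digits:
  assumes "u \<in> {0..<1}" "y \<in> {0..1}" "z \<in> {0..1}"
  shows HC_3D_digit_0: "HC_3D (u / 3, y, z) = (u, 2/3 * y, z / 2)"
    and HC_3D_digit_1: "HC_3D ((1 + u) / 3, y, z) = (u, 2/3 * y, 1 - (1 - z) / 2)"
    and HC_3D_digit_2: "HC_3D ((2 + u) / 3, y, 1 - (1 - z) / 2) = (u, 1 - (1 - y) / 6, z)"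
  using assms tau_branch[of u 0] tau_branch[of u 1] tau_branch[of u 2]
  by (auto simp: HC_3D_def HC_A_def HC_B_def HC_C_def HC_D_def field_simps)

lemma in_unit_interval_power:
  fixes u c :: real
  assumes "1 \<le> c"
  shows "u \<in> {0..<1} \<Longrightarrow> u / c ^ m \<in> {0..<1}"
    and "u \<in> {0..<1} \<Longrightarrow> 1 - (1 - u) / c ^ m \<in> {0..<1}"
    and "u \<in> {0..1} \<Longrightarrow> 1 - (1 - u) / c ^ m \<in> {0..1}"
proof -
  have c: "1 \<le> c ^ m" using assms by simp
  then have "u \<in> {0..<1} \<Longrightarrow> u < c ^ m" "u \<in> {0..1} \<Longrightarrow> 1 - u \<le> c ^ m"
    by auto
  with c show "u \<in> {0..<1} \<Longrightarrow> u / c ^ m \<in> {0..<1}"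
    and "u \<in> {0..<1} \<Longrightarrow> 1 - (1 - u) / c ^ m \<in> {0..<1}"
    and "u \<in> {0..1} \<Longrightarrow> 1 - (1 - u) / c ^ m \<in> {0..1}"
    by auto
qed

text \<open>A run of \<open>m\<close> digits \<open>0\<close> contracts \<open>y\<close> and \<open>z\<close> towards \<open>0\<close>.\<close>

lemma HC_3D_run_0:
  assumes "u \<in> {0..<1}" "y \<in> {0..1}" "z \<in> {0..1}"
  shows "(HC_3D ^^ m) (u / 3 ^ m, y, z) = (u, (2/3) ^ m * y, z / 2 ^ m)"
  using assms(2,3)
proof (induction m arbitrary: y z)
  case (Suc m)
  have "HC_3D (u / 3 ^ Suc m, y, z) = (u / 3 ^ m, 2/3 * y, z / 2)"
    using HC_3D_digit_0[of "u / 3 ^ m" y z] in_unit_interval_power(1)[OF _ assms(1), of 3 m] Suc.prems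
    by (simp add: mult.commute)
  then show ?case
    using Suc.IH[of "2/3 * y" "z / 2"] Suc.prems by (simp add: funpow_Suc_right del: funpow.simps)
qed simp

text \<open>A run of \<open>m\<close> digits \<open>1\<close>, written around the fixed point \<open>1/2\<close> of that branch of \<open>tau\<close>,
  fills the stack with ones.\<close>

lemma HC_3D_run_1:
  assumes "u \<in> {0..<1}" "y \<in> {0..1}" "z \<in> {0..1}"
  shows "(HC_3D ^^ m) (1/2 + (u - 1/2) / 3 ^ m, y, z) = (u, (2/3) ^ m * y, 1 - (1 - z) / 2 ^ m)"
  using assms(2,3)
proof (induction m arbitrary: y z)
  case (Suc m)
  define v where "v = 1/2 + (u - 1/2) / 3 ^ m"
  have "v \<in> {0..<1}"
  proof -
    have "(1::real) \<le> 3 ^ m" by simp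
    then have "- (1/2) * 3 ^ m \<le> u - 1/2" "u - 1/2 < 1/2 * 3 ^ m"
      using assms(1) unfolding atLeastLessThan_iff by linarith+
    then have "- (1/2) \<le> (u - 1/2) / 3 ^ m" "(u - 1/2) / 3 ^ m < 1/2"
      by (simp_all only: le_divide_eq divide_less_eq zero_less_power zero_less_numeral if_True)
    then have "0 \<le> v" "v < 1"
      unfolding v_def by linarith+
    then show ?thesis by simp
  qed
  moreover have "1/2 + (u - 1/2) / 3 ^ Suc m = (1 + v) / 3"
    by (simp add: v_def field_simps)
  ultimately have "HC_3D (1/2 + (u - 1/2) / 3 ^ Suc m, y, z) = (v, 2/3 * y, 1 - (1 - z) / 2)"
    using HC_3D_digit_1[of v y z] Suc.prems by (simp only:)
  then show ?case
    using Suc.IH[of "2/3 * y" "1 - (1 - z) / 2"] Suc.prems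
    by (simp add: funpow_Suc_right v_def[symmetric] del: funpow.simps)
qed simp

text \<open>A run of \<open>m\<close> digits \<open>2\<close> started with \<open>m\<close> ones on top of the stack pops them all and
  contracts \<open>y\<close> towards \<open>1\<close>.\<close>

lemma HC_3D_run_2:
  assumes "u \<in> {0..<1}" "y \<in> {0..1}" "z \<in> {0..1}"
  shows "(HC_3D ^^ m) (1 - (1 - u) / 3 ^ m, y, 1 - (1 - z) / 2 ^ m) = (u, 1 - (1 - y) / 6 ^ m, z)"
  using assms(2)
proof (induction m arbitrary: y)
  case (Suc m)
  define v where "v = 1 - (1 - u) / 3 ^ m"
  define w where "w = 1 - (1 - z) / 2 ^ m"
  have v: "v \<in> {0..<1}"
    unfolding v_def using assms(1) by (intro in_unit_interval_power) auto
  have w: "w \<in> {0..1}"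
    unfolding w_def using assms(3) by (intro in_unit_interval_power) auto
  have "1 - (1 - u) / 3 ^ Suc m = (2 + v) / 3" "1 - (1 - z) / 2 ^ Suc m = 1 - (1 - w) / 2"
    by (simp_all add: v_def w_def field_simps)
  then have "HC_3D (1 - (1 - u) / 3 ^ Suc m, y, 1 - (1 - z) / 2 ^ Suc m) = (v, 1 - (1 - y) / 6, w)"
    using HC_3D_digit_2[OF v Suc.prems w] by (simp only:)
  then show ?case
    using Suc.IH[of "1 - (1 - y) / 6"] Suc.prems
    by (simp add: funpow_Suc_right v_def[symmetric] w_def[symmetric] del: funpow.simps)
qed simp

lemma dist_triple_le:
  fixes x y z a b c :: real
  shows "dist (x, y, z) (a, b, c) \<le> \<bar>x - a\<bar> + \<bar>y - b\<bar> + \<bar>z - c\<bar>"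
proof -
  have "norm (x - a, y - b, z - c) \<le> norm (x - a) + norm (y - b, z - c)"
    by (rule norm_Pair_le)
  also have "norm (y - b, z - c) \<le> norm (y - b) + norm (z - c)"
    by (rule norm_Pair_le)
  finally show ?thesis by (simp add: dist_norm)
qed

text \<open>In the interval the first \<open>4 * k\<close> digits are \<open>0\<close>. Reading \<open>3 * k\<close> of them brings \<open>y\<close> and
  \<open>z\<close> close to \<open>0\<close>, and the remaining \<open>k\<close> keep the first coordinate close to \<open>0\<close>. The number
  \<open>3 * k\<close> of steps is the one that a visit to the opposite corner takes.\<close>

lemma HC_3D_near_origin:
  assumes p: "p \<in> unit_cube" "fst p \<in> {0<..<1 / 3 ^ (4 * k)}"
  shows "dist ((HC_3D ^^ (3 * k)) p) (0, 0, 0) \<le> 3 * (2/3) ^ k"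
proof -
  obtain x y z where xyz: "p = (x, y, z)" by (cases p)
  define u where "u = 3 ^ (3 * k) * x"
  have yz: "y \<in> {0..1}" "z \<in> {0..1}" and x: "0 < x" "x < 1 / 3 ^ (4 * k)"
    using p by (auto simp: xyz unit_cube_def)
  have "(3::real) ^ (4 * k) = 3 ^ (3 * k) * 3 ^ k"
    by (simp flip: power_add)
  then have u: "0 \<le> u" "u < (1/3) ^ k"
    using x by (auto simp: u_def field_simps)
  have "(1/3) ^ k \<le> (1::real)"
    by (simp add: power_le_one)
  then have "u < 1"
    using u by linarith
  then have F: "(HC_3D ^^ (3 * k)) p = (u, (2/3) ^ (3 * k) * y, z / 2 ^ (3 * k))"
    using HC_3D_run_0[of u y z "3 * k"] u yz by (simp add: xyz u_def)
  have "(2/3) ^ (3 * k) * y \<le> (2/3) ^ k * 1"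
    using yz by (intro mult_mono power_decreasing) auto
  moreover have "z / 2 ^ (3 * k) \<le> (2/3) ^ k"
  proof -
    have "z / 2 ^ (3 * k) \<le> (1/2) ^ (3 * k)" using yz by (simp add: power_one_over divide_right_mono)
    also have "\<dots> \<le> (1/2) ^ k" by (intro power_decreasing) auto
    also have "\<dots> \<le> (2/3) ^ k" by (intro power_mono) auto
    finally show ?thesis .
  qed
  moreover have "u \<le> (2/3) ^ k"
    using u(2) power_mono[of "1/3 :: real" "2/3" k] by simp
  ultimately show ?thesis
    using dist_triple_le[of u "(2/3) ^ (3 * k) * y" "z / 2 ^ (3 * k)" 0 0 0] u yz
    unfolding F by simp
qed

text \<open>The interval is the interior of the set of expansions that begin with \<open>2 * k\<close> digits
  \<open>1\<close> followed by \<open>2 * k\<close> digits \<open>2\<close>. The ones fill the stack; the first \<open>k\<close> twos consume half of them and drive \<open>y\<close> to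
  \<open>1\<close>; the \<open>k\<close> ones left on the stack keep \<open>z\<close> close to \<open>1\<close>, and the \<open>k\<close> twos still to be read
  keep the first coordinate close to \<open>1\<close>.\<close>

lemma HC_3D_near_corner:
  assumes p: "p \<in> unit_cube"
    "fst p \<in> {1/2 + (1/2 - 1 / 3 ^ (2 * k)) / 3 ^ (2 * k)<..<1/2 + 1/2 / 3 ^ (2 * k)}"
  shows "dist ((HC_3D ^^ (3 * k)) p) (1, 1, 1) \<le> 3 * (2/3) ^ k"
proof -
  obtain x y z where xyz: "p = (x, y, z)" by (cases p)
  \<comment> \<open>\<open>u\<close> is the first coordinate after the ones, \<open>v\<close> the one after half of the twos.\<close>
  define u where "u = 1/2 + 3 ^ (2 * k) * (x - 1/2)"
  define v where "v = 1 - 3 ^ k * (1 - u)"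
  define y' where "y' = (2/3) ^ (2 * k) * y"
  define z' where "z' = 1 - (1 - z) / 2 ^ k"
  have yz: "y \<in> {0..1}" "z \<in> {0..1}"
    and x: "(1/2 - 1 / 3 ^ (2 * k)) / 3 ^ (2 * k) < x - 1/2" "x - 1/2 < 1/2 / 3 ^ (2 * k)"
    using p by (auto simp: xyz unit_cube_def)
  have u: "1 - 1 / 3 ^ (2 * k) < u" "u < 1"
    using x by (auto simp: u_def field_simps)
  have sq: "(3::real) ^ (2 * k) = 3 ^ k * 3 ^ k" "(2::real) ^ (2 * k) = 2 ^ k * 2 ^ k"
    by (simp_all add: power_add mult_2)
  have "3 ^ k * (1 - u) < 3 ^ k * (1 / 3 ^ (2 * k))"
    using u by (intro mult_strict_left_mono) auto
  then have v: "1 - (1/3) ^ k < v" "v < 1"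
    using u by (auto simp: v_def sq power_one_over)
  have le1: "(1/3) ^ k \<le> (1::real)" "1 / 3 ^ (2 * k) \<le> (1::real)"
    by (simp_all add: power_le_one)
  have y': "y' \<in> {0..1}"
    using yz by (auto simp: y'_def intro!: mult_le_one power_le_one)
  have z': "z' \<in> {0..1}"
    unfolding z'_def using yz(2) by (intro in_unit_interval_power) auto
  have "x = 1/2 + (u - 1/2) / 3 ^ (2 * k)"
    by (simp add: u_def)
  then have 1: "(HC_3D ^^ (2 * k)) p = (u, y', 1 - (1 - z) / 2 ^ (2 * k))"
    using HC_3D_run_1[of u y z "2 * k"] u le1 yz by (simp add: xyz y'_def)
  have "u = 1 - (1 - v) / 3 ^ k" "1 - (1 - z) / 2 ^ (2 * k) = 1 - (1 - z') / 2 ^ k"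
    by (simp_all add: v_def z'_def sq)
  then have 2: "(HC_3D ^^ k) (u, y', 1 - (1 - z) / 2 ^ (2 * k)) = (v, 1 - (1 - y') / 6 ^ k, z')"
    using HC_3D_run_2[of v y' z' k] v le1 y' z' by simp
  have "3 * k = k + 2 * k" by simp
  then have F: "(HC_3D ^^ (3 * k)) p = (v, 1 - (1 - y') / 6 ^ k, z')"
    using 1 2 by (simp only: funpow_add o_apply)
  have "\<bar>v - 1\<bar> \<le> (2/3) ^ k"
    using v power_mono[of "1/3 :: real" "2/3" k] by simp
  moreover have "\<bar>1 - (1 - y') / 6 ^ k - 1\<bar> \<le> (2/3) ^ k"
  proof -
    have "(1 - y') / 6 ^ k \<le> (1/6) ^ k" using y' by (simp add: power_one_over divide_right_mono)
    also have "\<dots> \<le> (2/3) ^ k" by (intro power_mono) auto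
    finally show ?thesis using y' by simp
  qed
  moreover have "\<bar>z' - 1\<bar> \<le> (2/3) ^ k"
  proof -
    have "(1 - z) / 2 ^ k \<le> (1/2) ^ k" using yz by (simp add: power_one_over divide_right_mono)
    also have "\<dots> \<le> (2/3) ^ k" by (intro power_mono) auto
    finally show ?thesis using yz by (simp add: z'_def)
  qed
  ultimately show ?thesis
    using dist_triple_le[of v "1 - (1 - y') / 6 ^ k" z' 1 1 1] unfolding F by linarith
qed

section \<open>Almost every pair is scrambled\<close>

text \<open>The first coordinates enter the prescribed intervals at a common time \<open>n k\<close>. The visit to
  \<open>(A, B)\<close> happens \<open>3 * k\<close> steps later, so its time is at least \<open>3 * k\<close> and the visiting times
  tend to infinity without any return-time argument.\<close>

lemma simultaneous_visits:
  fixes a b c d :: "nat \<Rightarrow> real"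
  assumes p: "p \<in> unit_cube" "q \<in> unit_cube" "(fst p, fst q) \<notin> exceptional"
    and ab: "\<And>k. 0 \<le> a k \<and> a k < b k \<and> b k \<le> 1" and cd: "\<And>k. 0 \<le> c k \<and> c k < d k \<and> d k \<le> 1"
    and A: "\<And>k v. v \<in> unit_cube \<Longrightarrow> fst v \<in> {a k<..<b k} \<Longrightarrow> dist ((HC_3D ^^ (3 * k)) v) A \<le> 3 * (2/3) ^ k"
    and B: "\<And>k v. v \<in> unit_cube \<Longrightarrow> fst v \<in> {c k<..<d k} \<Longrightarrow> dist ((HC_3D ^^ (3 * k)) v) B \<le> 3 * (2/3) ^ k"
  obtains r where "filterlim r at_top sequentially"
    "(\<lambda>k. (HC_3D ^^ r k) p) \<longlonglongrightarrow> A" "(\<lambda>k. (HC_3D ^^ r k) q) \<longlonglongrightarrow> B"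
proof -
  have "\<exists>n. (tau ^^ n) (fst p) \<in> {a k<..<b k} \<and> (tau ^^ n) (fst q) \<in> {c k<..<d k}" for k
  proof -
    have "fst p \<in> {0..1}" "fst q \<in> {0..1}"
      using p by (auto simp: unit_cube_def)
    then show ?thesis
      using orbit_dense_outside_exceptional[of "fst p" "fst q" "a k" "b k" "c k" "d k"] p(3) ab cd
      by metis
  qed
  then obtain n where n: "\<And>k. (tau ^^ n k) (fst p) \<in> {a k<..<b k}"
    "\<And>k. (tau ^^ n k) (fst q) \<in> {c k<..<d k}"
    by metis
  define r where "r = (\<lambda>k. 3 * k + n k)"
  have bound: "dist ((HC_3D ^^ r k) p) A \<le> 3 * (2/3) ^ k" "dist ((HC_3D ^^ r k) q) B \<le> 3 * (2/3) ^ k" for k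
    using A[of "(HC_3D ^^ n k) p" k] B[of "(HC_3D ^^ n k) q" k] n[of k] p(1,2)
    by (simp_all add: r_def funpow_add fst_HC_3D_funpow HC_3D_funpow_cube)
  have zero: "(\<lambda>k. 3 * (2/3) ^ k :: real) \<longlonglongrightarrow> 0"
    by (intro tendsto_mult_right_zero LIMSEQ_power_zero) simp
  show thesis
  proof
    show "filterlim r at_top sequentially"
      by (rule filterlim_at_top_mono[OF filterlim_ident]) (simp add: r_def)
    show "(\<lambda>k. (HC_3D ^^ r k) p) \<longlonglongrightarrow> A" "(\<lambda>k. (HC_3D ^^ r k) q) \<longlonglongrightarrow> B"
      by (rule metric_tendsto_imp_tendsto[OF zero]; simp add: bound)+
  qed
qed

text \<open>Both points run through zeros for the approach; for the separation the first point reads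
  zeros while the second reads ones and then twos.\<close>

lemma HC_3D_visits:
  assumes p: "p \<in> unit_cube" "q \<in> unit_cube" "(fst p, fst q) \<notin> exceptional"
  obtains r s where
    "filterlim r at_top sequentially"
    "(\<lambda>k. (HC_3D ^^ r k) p) \<longlonglongrightarrow> (0, 0, 0)" "(\<lambda>k. (HC_3D ^^ r k) q) \<longlonglongrightarrow> (0, 0, 0)"
    "filterlim s at_top sequentially"
    "(\<lambda>k. (HC_3D ^^ s k) p) \<longlonglongrightarrow> (0, 0, 0)" "(\<lambda>k. (HC_3D ^^ s k) q) \<longlonglongrightarrow> (1, 1, 1)"
proof -
  have near0: "0 \<le> (0::real) \<and> 0 < 1 / (3::real) ^ (4 * k) \<and> 1 / (3::real) ^ (4 * k) \<le> 1" for k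
    by simp
  have near1: "0 \<le> 1/2 + (1/2 - 1 / (3::real) ^ (2 * k)) / 3 ^ (2 * k) \<and>
      1/2 + (1/2 - 1 / (3::real) ^ (2 * k)) / 3 ^ (2 * k) < 1/2 + 1/2 / 3 ^ (2 * k) \<and>
      1/2 + 1/2 / (3::real) ^ (2 * k) \<le> 1" for k
  proof -
    define e where "e = 1 / (3::real) ^ (2 * k)"
    have e: "0 < e" "e \<le> 1" by (simp_all add: e_def)
    then have "0 < e * e" "e * e \<le> e"
      by (simp_all add: mult_left_le)
    then have "0 \<le> 1/2 + (1/2 - e) * e \<and> 1/2 + (1/2 - e) * e < 1/2 + 1/2 * e \<and> 1/2 + 1/2 * e \<le> 1"
      using e unfolding left_diff_distrib by (intro conjI; linarith)
    then show ?thesis by (simp add: e_def)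
  qed
  obtain r where "filterlim r at_top sequentially"
    "(\<lambda>k. (HC_3D ^^ r k) p) \<longlonglongrightarrow> (0, 0, 0)" "(\<lambda>k. (HC_3D ^^ r k) q) \<longlonglongrightarrow> (0, 0, 0)"
    by (rule simultaneous_visits[OF p near0 near0 HC_3D_near_origin HC_3D_near_origin])
  moreover obtain s where "filterlim s at_top sequentially"
    "(\<lambda>k. (HC_3D ^^ s k) p) \<longlonglongrightarrow> (0, 0, 0)" "(\<lambda>k. (HC_3D ^^ s k) q) \<longlonglongrightarrow> (1, 1, 1)"
    by (rule simultaneous_visits[OF p near0 near1 HC_3D_near_origin HC_3D_near_corner])
  ultimately show thesis by (rule that)
qed

lemma diff_unit_power2_le: "s \<in> {0..1} \<Longrightarrow> t \<in> {0..1} \<Longrightarrow> (s - t)\<^sup>2 \<le> (1::real)"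
  by (auto simp: abs_square_le_1 abs_le_iff)

lemma unit_square_dist_le:
  "p \<in> unit_square \<Longrightarrow> q \<in> unit_square \<Longrightarrow> dist p q \<le> dist (0::real, 0::real) (1, 1)"
  unfolding unit_square_def
  by (cases p; cases q) (auto simp: dist_Pair_Pair dist_real_def
      intro!: add_mono[OF diff_unit_power2_le diff_unit_power2_le, THEN order_trans])

lemma unit_cube_dist_le:
  "p \<in> unit_cube \<Longrightarrow> q \<in> unit_cube \<Longrightarrow> dist p q \<le> dist (0::real, 0::real, 0::real) (1, 1, 1)"
  unfolding unit_cube_def
  by (cases p; cases q) (auto simp: dist_Pair_Pair dist_real_def
      intro!: add_mono[OF diff_unit_power2_le add_mono[OF diff_unit_power2_le diff_unit_power2_le], THEN order_trans])

lemma scrambled_pair_HC_3D: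
  assumes "p \<in> unit_cube" "q \<in> unit_cube" "(fst p, fst q) \<notin> exceptional"
  shows "scrambled_pair unit_cube HC_3D p q"
proof (rule HC_3D_visits[OF assms], rule scrambled_pairI)
  show "(HC_3D ^^ n) p \<in> unit_cube" "(HC_3D ^^ n) q \<in> unit_cube" for n
    using assms by (simp_all add: HC_3D_funpow_cube)
  show "(0, 0, 0) \<in> unit_cube" "(1, 1, 1) \<in> unit_cube"
    by (simp_all add: unit_cube_def)
qed (assumption | rule unit_cube_dist_le)+

lemma scrambled_pair_HC_2D:
  assumes "p \<in> unit_square" "q \<in> unit_square" "(fst p, fst q) \<notin> exceptional"
  shows "scrambled_pair unit_square HC_2D p q"
proof -
  define lift where "lift = (\<lambda>v :: real \<times> real. (fst v, 0 :: real, snd v))"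
  have lift: "lift v \<in> unit_cube" "(HC_2D ^^ n) v = proj_xz ((HC_3D ^^ n) (lift v))"
    if "v \<in> unit_square" for v n
  proof -
    show "lift v \<in> unit_cube"
      using that by (auto simp: lift_def unit_cube_def unit_square_def)
    moreover have "proj_xz (lift v) = v"
      by (simp add: lift_def proj_xz_def)
    ultimately show "(HC_2D ^^ n) v = proj_xz ((HC_3D ^^ n) (lift v))"
      using HC_2D_funpow_proj[of "lift v" n] by simp
  qed
  have proj_lim: "(\<lambda>k. (HC_2D ^^ r k) v) \<longlonglongrightarrow> proj_xz l"
    if "v \<in> unit_square" "(\<lambda>k. (HC_3D ^^ r k) (lift v)) \<longlonglongrightarrow> l" for v l and r :: "nat \<Rightarrow> nat"
    unfolding lift(2)[OF that(1)] proj_xz_def case_prod_unfold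
    by (intro tendsto_intros that(2))
  have ne: "(fst (lift p), fst (lift q)) \<notin> exceptional"
    using assms(3) by (simp add: lift_def)
  obtain r s where r: "filterlim r at_top sequentially"
      "(\<lambda>k. (HC_3D ^^ r k) (lift p)) \<longlonglongrightarrow> (0, 0, 0)" "(\<lambda>k. (HC_3D ^^ r k) (lift q)) \<longlonglongrightarrow> (0, 0, 0)"
    and s: "filterlim s at_top sequentially"
      "(\<lambda>k. (HC_3D ^^ s k) (lift p)) \<longlonglongrightarrow> (0, 0, 0)" "(\<lambda>k. (HC_3D ^^ s k) (lift q)) \<longlonglongrightarrow> (1, 1, 1)"
    by (rule HC_3D_visits[OF lift(1)[OF assms(1)] lift(1)[OF assms(2)] ne])
  have orbit: "(HC_2D ^^ n) v \<in> unit_square" if "v \<in> unit_square" for v n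
    using HC_3D_funpow_cube[OF lift(1)[OF that], of n] lift(2)[OF that, of n]
    by (auto simp: unit_cube_def unit_square_def proj_xz_def case_prod_unfold)
  show ?thesis
  proof (rule scrambled_pairI)
    show "(0, 0) \<in> unit_square" "(1, 1) \<in> unit_square"
      by (simp_all add: unit_square_def)
    show "(\<lambda>k. (HC_2D ^^ r k) p) \<longlonglongrightarrow> (0, 0)" "(\<lambda>k. (HC_2D ^^ r k) q) \<longlonglongrightarrow> (0, 0)"
      "(\<lambda>k. (HC_2D ^^ s k) p) \<longlonglongrightarrow> (0, 0)" "(\<lambda>k. (HC_2D ^^ s k) q) \<longlonglongrightarrow> (1, 1)"
      using proj_lim[OF assms(1) r(2)] proj_lim[OF assms(2) r(3)]
        proj_lim[OF assms(1) s(2)] proj_lim[OF assms(2) s(3)]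
      by (simp_all add: proj_xz_def)
  qed (use r(1) s(1) assms orbit unit_square_dist_le in auto)
qed

theorem theorem1p3:
  shows "(AE (p1, p2) in lebesgue_on (unit_square \<times> unit_square).
            scrambled_pair unit_square HC_2D p1 p2) \<and>
         (AE (p1, p2) in lebesgue_on (unit_cube \<times> unit_cube).
            scrambled_pair unit_cube HC_3D p1 p2)"
proof
  have "closed unit_square" "closed unit_cube"
    unfolding unit_square_def unit_cube_def by (intro closed_Times closed_atLeastAtMost)+
  then have borel: "unit_square \<in> sets borel" "unit_cube \<in> sets borel"
    by (auto intro: borel_closed)
  show "AE (p1, p2) in lebesgue_on (unit_square \<times> unit_square).
      scrambled_pair unit_square HC_2D p1 p2"
    using exceptional_null borel(1) scrambled_pair_HC_2D by (rule AE_lebesgue_onI)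
  show "AE (p1, p2) in lebesgue_on (unit_cube \<times> unit_cube).
      scrambled_pair unit_cube HC_3D p1 p2"
    using exceptional_null borel(2) scrambled_pair_HC_3D by (rule AE_lebesgue_onI)
qed

end
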